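(* Let $(I,\tilde g,V,\lambda,\mu)$ be an almost $\eta$-Ricci soliton with $\eta=dx^3$ and $V=\sum_{k=1}^3V^kE_k$. Suppose that $f_1=f_1(x^1)$ depends only on $x^1$, $f_2=f_2(x^3)$ depends only on $x^3$, and $V^1,V^2,V^3$ depend only on $x^3$. Put $d=\frac{f_2'}{f_2}$. Then there are $c_1,c_2\in\mathbb R$ such that $$V^1=c_1,\quad V^2=\frac{c_2}{f_2},\quad dV^3=d'-d^2,\quad \lambda=0,\quad d^2\mu=(d')^2+d^4-dd''.$$ Moreover, the following hold (in each case $c_1,c_2$ denote some real constants). (i) On any open interval $J_3\subseteq I_3$ on which $f_2$ is constant: $V^1=c_1$, $V^2=c_2$, $V^3=F$, $\lambda=0$, where $F'=-\mu$. (ii) On any open interval $J_3\subseteq I_3$ on which $f_2'\neq0$ everywhere (equivalently, $d\neq0$ everywhere on $J_3$): $$V^1=c_1,\quad V^2=\frac{c_2}{f_2},\quad V^3=\frac{d'-d^2}{d},\quad \lambda=0,\quad \mu=-\frac{d''}{d}+\left(\frac{d'}{d}\right)^2+d^2.$$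
   Context: Let $I=I_1\times I_2\times I_3\subseteq\mathbb R^3$ with $I_1,I_2,I_3\subseteq\mathbb R$ open intervals and standard coordinates $x^1,x^2,x^3$. Let $f_1,f_2$ be smooth nowhere zero functions on $I$ and endow $I$ with the Riemannian metric $\tilde g=\frac{1}{f_1^2}dx^1\otimes dx^1+\frac{1}{f_2^2}dx^2\otimes dx^2+dx^3\otimes dx^3$. Let $E_1=f_1\frac{\partial}{\partial x^1}$, $E_2=f_2\frac{\partial}{\partial x^2}$, $E_3=\frac{\partial}{\partial x^3}$ (an orthonormal frame). For a smooth vector field $V$, a $1$-form $\eta$, and smooth functions $\lambda,\mu$ on $I$ with $\mu\neq0$ (not identically zero), $(I,\tilde g,V,\lambda,\mu)$ is an almost $\eta$-Ricci soliton if $\frac12\pounds_V\tilde g+\mathrm{Ric}+\lambda\tilde g+\mu\,\eta\otimes\eta=0$ on $I$, where $\pounds_V\tilde g$ is the Lie derivative of $\tilde g$ along $V$ and $\mathrm{Ric}$ is the Ricci tensor of $\tilde g$, with $\mathrm{Ric}(Y,Z)=\sum_{k}\tilde g(R(E_k,Y)Z,E_k)$, $R(X,Y)Z=\nabla_X\nabla_YZ-\nabla_Y\nabla_XZ-\nabla_{[X,Y]}Z$, $\nabla$ the Levi-Civita connection. Functions of one coordinate alone are regarded as functions on the corresponding interval, and a prime denotes the derivative with respect to $x^3$. *)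

theory Defs
  imports "HOL-Analysis.Analysis"
begin

text \<open>
  Calculus of tensor fields on an open subset \<open>S\<close> of a Euclidean space.  Every tangent space is
  identified with the ambient space, so a vector field is a map \<open>'a \<Rightarrow> 'a\<close>, a 1-form a map
  \<open>'a \<Rightarrow> 'a \<Rightarrow> real\<close> and a metric a map \<open>'a \<Rightarrow> 'a \<Rightarrow> 'a \<Rightarrow> real\<close>.  Values outside \<open>S\<close> are irrelevant;
  every condition below is imposed on \<open>S\<close> only.
\<close>

fun higher_differentiable_on ::
  "'a::real_normed_vector set \<Rightarrow> ('a \<Rightarrow> 'b::real_normed_vector) \<Rightarrow> nat \<Rightarrow> bool" where
  "higher_differentiable_on S f 0 \<longleftrightarrow> continuous_on S f"
| "higher_differentiable_on S f (Suc n) \<longleftrightarrow>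
     (\<forall>x\<in>S. f differentiable (at x)) \<and>
     (\<forall>v. higher_differentiable_on S (\<lambda>x. frechet_derivative f (at x) v) n)"

text \<open>For open \<open>S\<close> this is the usual notion of a \<open>C\<^sup>\<infinity>\<close> map on \<open>S\<close>.\<close>

definition smooth_on ::
  "'a::real_normed_vector set \<Rightarrow> ('a \<Rightarrow> 'b::real_normed_vector) \<Rightarrow> bool" where
  "smooth_on S f \<longleftrightarrow> (\<forall>n. higher_differentiable_on S f n)"

text \<open>The derivative \<open>X(f)\<close> of a function \<open>f\<close> along a vector field \<open>X\<close>.\<close>

definition deriv_along ::
  "('a::euclidean_space \<Rightarrow> 'a) \<Rightarrow> ('a \<Rightarrow> real) \<Rightarrow> 'a \<Rightarrow> real" where
  "deriv_along X f p = frechet_derivative f (at p) (X p)"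

definition lie_bracket ::
  "('a::euclidean_space \<Rightarrow> 'a) \<Rightarrow> ('a \<Rightarrow> 'a) \<Rightarrow> 'a \<Rightarrow> 'a" where
  "lie_bracket X Y p = frechet_derivative Y (at p) (X p) - frechet_derivative X (at p) (Y p)"

definition affine_connection_on ::
  "'a::euclidean_space set \<Rightarrow> (('a \<Rightarrow> 'a) \<Rightarrow> ('a \<Rightarrow> 'a) \<Rightarrow> 'a \<Rightarrow> 'a) \<Rightarrow> bool" where
  "affine_connection_on S D \<longleftrightarrow>
     (\<forall>X Y. smooth_on S X \<longrightarrow> smooth_on S Y \<longrightarrow> smooth_on S (D X Y)) \<and>
     (\<forall>X X' Y. smooth_on S X \<longrightarrow> smooth_on S X' \<longrightarrow> smooth_on S Y \<longrightarrow>
        (\<forall>p\<in>S. D (\<lambda>q. X q + X' q) Y p = D X Y p + D X' Y p)) \<and>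
     (\<forall>f X Y. smooth_on S (f :: 'a \<Rightarrow> real) \<longrightarrow> smooth_on S X \<longrightarrow> smooth_on S Y \<longrightarrow>
        (\<forall>p\<in>S. D (\<lambda>q. f q *\<^sub>R X q) Y p = f p *\<^sub>R D X Y p)) \<and>
     (\<forall>X Y Y'. smooth_on S X \<longrightarrow> smooth_on S Y \<longrightarrow> smooth_on S Y' \<longrightarrow>
        (\<forall>p\<in>S. D X (\<lambda>q. Y q + Y' q) p = D X Y p + D X Y' p)) \<and>
     (\<forall>f X Y. smooth_on S (f :: 'a \<Rightarrow> real) \<longrightarrow> smooth_on S X \<longrightarrow> smooth_on S Y \<longrightarrow>
        (\<forall>p\<in>S. D X (\<lambda>q. f q *\<^sub>R Y q) p = deriv_along X f p *\<^sub>R Y p + f p *\<^sub>R D X Y p))"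

text \<open>The torsion-free connection compatible with the metric \<open>g\<close>.\<close>

definition levi_civita_connection_on ::
  "'a::euclidean_space set \<Rightarrow> ('a \<Rightarrow> 'a \<Rightarrow> 'a \<Rightarrow> real) \<Rightarrow>
   (('a \<Rightarrow> 'a) \<Rightarrow> ('a \<Rightarrow> 'a) \<Rightarrow> 'a \<Rightarrow> 'a) \<Rightarrow> bool" where
  "levi_civita_connection_on S g D \<longleftrightarrow>
     affine_connection_on S D \<and>
     (\<forall>X Y. smooth_on S X \<longrightarrow> smooth_on S Y \<longrightarrow>
        (\<forall>p\<in>S. D X Y p - D Y X p = lie_bracket X Y p)) \<and>
     (\<forall>X Y Z. smooth_on S X \<longrightarrow> smooth_on S Y \<longrightarrow> smooth_on S Z \<longrightarrow>
        (\<forall>p\<in>S. deriv_along X (\<lambda>q. g q (Y q) (Z q)) p =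
                g p (D X Y p) (Z p) + g p (Y p) (D X Z p)))"

definition curvature ::
  "(('a::euclidean_space \<Rightarrow> 'a) \<Rightarrow> ('a \<Rightarrow> 'a) \<Rightarrow> 'a \<Rightarrow> 'a) \<Rightarrow>
   ('a \<Rightarrow> 'a) \<Rightarrow> ('a \<Rightarrow> 'a) \<Rightarrow> ('a \<Rightarrow> 'a) \<Rightarrow> 'a \<Rightarrow> 'a" where
  "curvature D X Y Z p = D X (D Y Z) p - D Y (D X Z) p - D (lie_bracket X Y) Z p"

text \<open>
  \<open>Ric(Y,Z) = \<Sum>\<^sub>k g(R(E\<^sub>k,Y)Z, E\<^sub>k)\<close>, where \<open>E\<close> is meant to be an orthonormal frame for \<open>g\<close>.
\<close>

definition ricci ::
  "('a::euclidean_space \<Rightarrow> 'a \<Rightarrow> 'a \<Rightarrow> real) \<Rightarrow> (('a \<Rightarrow> 'a) \<Rightarrow> ('a \<Rightarrow> 'a) \<Rightarrow> 'a \<Rightarrow> 'a) \<Rightarrow>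
   ('k::finite \<Rightarrow> 'a \<Rightarrow> 'a) \<Rightarrow> ('a \<Rightarrow> 'a) \<Rightarrow> ('a \<Rightarrow> 'a) \<Rightarrow> 'a \<Rightarrow> real" where
  "ricci g D E Y Z p = (\<Sum>k\<in>UNIV. g p (curvature D (E k) Y Z p) (E k p))"

definition lie_deriv_metric ::
  "('a::euclidean_space \<Rightarrow> 'a) \<Rightarrow> ('a \<Rightarrow> 'a \<Rightarrow> 'a \<Rightarrow> real) \<Rightarrow>
   ('a \<Rightarrow> 'a) \<Rightarrow> ('a \<Rightarrow> 'a) \<Rightarrow> 'a \<Rightarrow> real" where
  "lie_deriv_metric V g X Y p =
     deriv_along V (\<lambda>q. g q (X q) (Y q)) p -
     g p (lie_bracket V X p) (Y p) - g p (X p) (lie_bracket V Y p)"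

definition one_form_on :: "'a::euclidean_space set \<Rightarrow> ('a \<Rightarrow> 'a \<Rightarrow> real) \<Rightarrow> bool" where
  "one_form_on S \<eta> \<longleftrightarrow>
     (\<forall>p\<in>S. linear (\<eta> p)) \<and> (\<forall>X. smooth_on S X \<longrightarrow> smooth_on S (\<lambda>p. \<eta> p (X p)))"

text \<open>
  \<open>(S,g,V,\<lambda>,\<mu>)\<close> is an almost \<open>\<eta>\<close>-Ricci soliton; \<open>D\<close> is meant to be the Levi-Civita connection of
  \<open>g\<close> and \<open>E\<close> an
  orthonormal frame.  The condition on \<open>\<mu>\<close> is that it does not vanish identically.
\<close>

definition almost_eta_ricci_soliton ::
  "'a::euclidean_space set \<Rightarrow> ('a \<Rightarrow> 'a \<Rightarrow> 'a \<Rightarrow> real) \<Rightarrow>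
   (('a \<Rightarrow> 'a) \<Rightarrow> ('a \<Rightarrow> 'a) \<Rightarrow> 'a \<Rightarrow> 'a) \<Rightarrow> ('k::finite \<Rightarrow> 'a \<Rightarrow> 'a) \<Rightarrow>
   ('a \<Rightarrow> 'a \<Rightarrow> real) \<Rightarrow> ('a \<Rightarrow> 'a) \<Rightarrow> ('a \<Rightarrow> real) \<Rightarrow> ('a \<Rightarrow> real) \<Rightarrow> bool" where
  "almost_eta_ricci_soliton S g D E \<eta> V lam \<mu> \<longleftrightarrow>
     smooth_on S V \<and> one_form_on S \<eta> \<and> smooth_on S lam \<and> smooth_on S \<mu> \<and>
     (\<exists>p\<in>S. \<mu> p \<noteq> 0) \<and>
     (\<forall>X Y. smooth_on S X \<longrightarrow> smooth_on S Y \<longrightarrow>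
        (\<forall>p\<in>S. 1 / 2 * lie_deriv_metric V g X Y p + ricci g D E X Y p +
                lam p * g p (X p) (Y p) + \<mu> p * (\<eta> p (X p) * \<eta> p (Y p)) = 0))"

definition box3 :: "real set \<Rightarrow> real set \<Rightarrow> real set \<Rightarrow> (real^3) set" where
  "box3 I1 I2 I3 = {p. p $ 1 \<in> I1 \<and> p $ 2 \<in> I2 \<and> p $ 3 \<in> I3}"

definition metric3 ::
  "(real^3 \<Rightarrow> real) \<Rightarrow> (real^3 \<Rightarrow> real) \<Rightarrow> real^3 \<Rightarrow> real^3 \<Rightarrow> real^3 \<Rightarrow> real" where
  "metric3 f1 f2 p u v =
     1 / (f1 p)\<^sup>2 * (u $ 1 * v $ 1) + 1 / (f2 p)\<^sup>2 * (u $ 2 * v $ 2) + u $ 3 * v $ 3"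

definition frame3 ::
  "(real^3 \<Rightarrow> real) \<Rightarrow> (real^3 \<Rightarrow> real) \<Rightarrow> 3 \<Rightarrow> real^3 \<Rightarrow> real^3" where
  "frame3 f1 f2 k p =
     (if k = 1 then f1 p *\<^sub>R axis 1 1 else if k = 2 then f2 p *\<^sub>R axis 2 1 else axis 3 1)"

definition dx3 :: "real^3 \<Rightarrow> real^3 \<Rightarrow> real" where
  "dx3 p v = v $ 3"

end

theory Submission
  imports Defs
begin

text \<open>
  Write \<open>d = f\<^sub>2' / f\<^sub>2\<close>.  The only non-zero bracket of the frame is \<open>[E\<^sub>2, E\<^sub>3] = - d E\<^sub>2\<close>, so by
  Koszul's formula the only non-zero derivatives are \<open>D E\<^sub>2 E\<^sub>2 = d E\<^sub>3\<close> and \<open>D E\<^sub>2 E\<^sub>3 = - d E\<^sub>2\<close>, and the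
  Ricci tensor is \<open>(d' - d\<^sup>2) (E\<^sup>2 \<otimes> E\<^sup>2 + E\<^sup>3 \<otimes> E\<^sup>3)\<close> in the dual frame.  The frame components
  \<open>(1,1)\<close>, \<open>(1,3)\<close>, \<open>(2,3)\<close>, \<open>(2,2)\<close>, \<open>(3,3)\<close> of the soliton equation then read \<open>\<lambda> = 0\<close>, \<open>V\<^sup>1' = 0\<close>,
  \<open>(f\<^sub>2 V\<^sup>2)' = 0\<close>, \<open>d V\<^sup>3 = d' - d\<^sup>2\<close> and \<open>\<mu> = - V\<^sup>3' - (d' - d\<^sup>2)\<close>.
\<close>

subsection \<open>Smooth maps on an open set\<close>

text \<open>\<open>frechet_derivative\<close> is a choice among all derivatives at the point. Maps
  agreeing near \<open>x\<close> have the same derivatives there, so the choices coincide even where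
  nothing is differentiable.\<close>

lemma frechet_derivative_cong_open:
  assumes "open S" "x \<in> S" "\<And>y. y \<in> S \<Longrightarrow> f y = g y"
  shows "frechet_derivative f (at x) = frechet_derivative g (at x)"
proof -
  have "(f has_derivative f') (at x) \<longleftrightarrow> (g has_derivative f') (at x)" for f'
    using assms by (metis has_derivative_transform_within_open)
  then show ?thesis
    by (simp add: frechet_derivative_def)
qed

lemma differentiable_cong_open:
  assumes "f differentiable (at x)" "open S" "x \<in> S" "\<And>y. y \<in> S \<Longrightarrow> f y = g y"
  shows "g differentiable (at x)"
  using assms by (metis differentiable_def has_derivative_transform_within_open)

lemma higher_differentiable_on_cong:
  assumes "higher_differentiable_on S f n" "open S" "\<And>x. x \<in> S \<Longrightarrow> f x = g x"
  shows "higher_differentiable_on S g n"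
  using assms
proof (induction n arbitrary: f g)
  case 0
  then show ?case
    using continuous_on_cong by force
next
  case (Suc n)
  have "higher_differentiable_on S (\<lambda>x. frechet_derivative g (at x) w) n" for w
  proof (rule Suc.IH)
    show "higher_differentiable_on S (\<lambda>x. frechet_derivative f (at x) w) n"
      using Suc.prems by simp
    show "frechet_derivative f (at x) w = frechet_derivative g (at x) w" if "x \<in> S" for x
      using frechet_derivative_cong_open[of S x f g] Suc.prems that by simp
  qed (use Suc.prems in simp)
  moreover have "g differentiable (at x)" if "x \<in> S" for x
    using differentiable_cong_open[of f x S g] Suc.prems that by simp
  ultimately show ?case
    by simp
qed

lemma smooth_on_cong:
  assumes "smooth_on S f" "open S" "\<And>x. x \<in> S \<Longrightarrow> f x = g x"
  shows "smooth_on S g"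
  using assms higher_differentiable_on_cong unfolding smooth_on_def by blast

lemma higher_differentiable_on_const: "higher_differentiable_on S (\<lambda>x. c) n"
  by (induction n arbitrary: c) simp_all

lemma smooth_on_const: "smooth_on S (\<lambda>x. c)"
  by (simp add: smooth_on_def higher_differentiable_on_const)

text \<open>A bounded linear map commutes with differentiation, so the induction passes from
  \<open>f\<close> to its directional derivatives. Below, smoothness of the frame, of
  \<open>d\<close> and of the brackets is reduced to this fact, which stands in for product and
  quotient rules.\<close>

lemma higher_differentiable_on_bounded_linear:
  assumes "bounded_linear L" "open S" "higher_differentiable_on S f n"
  shows "higher_differentiable_on S (\<lambda>x. L (f x)) n"
  using assms(3)
proof (induction n arbitrary: f)
  case 0
  then show ?case
    using bounded_linear.continuous_on[OF assms(1)] by simp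
next
  case (Suc n)
  have der: "((\<lambda>x. L (f x)) has_derivative (\<lambda>h. L (frechet_derivative f (at x) h))) (at x)"
    if "x \<in> S" for x
    using Suc.prems that
    by (intro bounded_linear.has_derivative[OF assms(1)]) (simp add: frechet_derivative_works[symmetric])
  have "higher_differentiable_on S (\<lambda>x. frechet_derivative (\<lambda>x. L (f x)) (at x) w) n" for w
  proof (rule higher_differentiable_on_cong)
    show "higher_differentiable_on S (\<lambda>x. L (frechet_derivative f (at x) w)) n"
      using Suc by simp
    show "L (frechet_derivative f (at x) w) = frechet_derivative (\<lambda>x. L (f x)) (at x) w"
      if "x \<in> S" for x
      using fun_cong[OF frechet_derivative_at[OF der[OF that]]] .
  qed (rule assms)
  then show ?case
    using der by (auto simp: differentiable_def)
qed

lemma smooth_on_bounded_linear: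
  assumes "smooth_on S f" "bounded_linear L" "open S"
  shows "smooth_on S (\<lambda>x. L (f x))"
  using assms higher_differentiable_on_bounded_linear unfolding smooth_on_def by blast

lemma smooth_on_imp_differentiable:
  assumes "smooth_on S f" "x \<in> S"
  shows "f differentiable (at x)"
  using assms by (metis higher_differentiable_on.simps(2) smooth_on_def)

text \<open>Along the line \<gamma> through \<open>p\<close> in direction \<open>k\<close>,
  \<open>f\<close> coincides with \<phi> near \<open>p $ k\<close>. Differentiability of \<phi> is
  thus inherited from \<open>f\<close>; the derivative of \<open>f\<close> then follows by the chain
  rule.\<close>

lemma function_of_one_coordinate:
  fixes f :: "real^'n \<Rightarrow> real"
  assumes "open S" "p \<in> S" "\<And>q. q \<in> S \<Longrightarrow> f q = \<phi> (q $ k)" "f differentiable (at p)"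
  shows "(\<phi> has_real_derivative deriv \<phi> (p $ k)) (at (p $ k))"
    and "(f has_derivative (\<lambda>h. deriv \<phi> (p $ k) * h $ k)) (at p)"
proof -
  define \<gamma> where "\<gamma> = (\<lambda>t. p + (t - p $ k) *\<^sub>R axis k (1::real))"
  have f': "(f has_derivative frechet_derivative f (at p)) (at p)"
    using assms(4) by (simp add: frechet_derivative_works[symmetric])
  have \<gamma>': "(\<gamma> has_derivative (\<lambda>h. h *\<^sub>R axis k 1)) (at (p $ k))"
    unfolding \<gamma>_def by (auto intro!: derivative_eq_intros)
  have \<gamma>_p: "\<gamma> (p $ k) = p"
    by (simp add: \<gamma>_def)
  define U where "U = \<gamma> -` S"
  have "continuous_on UNIV \<gamma>"
    unfolding \<gamma>_def by (intro continuous_intros)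
  then have U: "open U" "p $ k \<in> U"
    using assms(1,2) \<gamma>_p by (auto simp: U_def open_vimage)
  have \<gamma>_k: "\<gamma> t $ k = t" for t
    by (simp add: \<gamma>_def)
  have "((\<lambda>t. f (\<gamma> t)) has_derivative (\<lambda>h. frechet_derivative f (at p) (h *\<^sub>R axis k 1)))
      (at (p $ k))"
    using has_derivative_compose[OF \<gamma>', of f] f' \<gamma>_p by simp
  then have "(\<phi> has_derivative (\<lambda>h. frechet_derivative f (at p) (h *\<^sub>R axis k 1))) (at (p $ k))"
    by (rule has_derivative_transform_within_open[OF _ U]) (simp add: U_def assms(3) \<gamma>_k)
  then have "\<phi> differentiable (at (p $ k))"
    by (auto simp: differentiable_def)
  then show *: "(\<phi> has_real_derivative deriv \<phi> (p $ k)) (at (p $ k))"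
    using DERIV_deriv_iff_real_differentiable by blast
  have "((\<lambda>q. \<phi> (q $ k)) has_derivative (\<lambda>h. deriv \<phi> (p $ k) * h $ k)) (at p)"
    using has_derivative_compose[OF bounded_linear.has_derivative[OF bounded_linear_vec_nth[of k] has_derivative_ident], of \<phi> _ p UNIV] *
    by (simp add: has_field_derivative_def)
  then show "(f has_derivative (\<lambda>h. deriv \<phi> (p $ k) * h $ k)) (at p)"
    by (rule has_derivative_transform_within_open[OF _ assms(1,2)]) (simp add: assms(3))
qed

subsection \<open>Connections\<close>

lemma affine_connection_on_smooth:
  assumes "affine_connection_on S D" "smooth_on S X" "smooth_on S Y"
  shows "smooth_on S (D X Y)"
  using assms(1) unfolding affine_connection_on_def by (simp add: assms(2,3))

lemma affine_connection_on_scale_left: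
  assumes "affine_connection_on S D" "smooth_on S f" "smooth_on S X" "smooth_on S Y" "p \<in> S"
  shows "D (\<lambda>q. f q *\<^sub>R X q) Y p = f p *\<^sub>R D X Y p"
  using assms unfolding affine_connection_on_def by blast

lemma affine_connection_on_scale_right:
  assumes "affine_connection_on S D" "smooth_on S f" "smooth_on S X" "smooth_on S Y" "p \<in> S"
  shows "D X (\<lambda>q. f q *\<^sub>R Y q) p = deriv_along X f p *\<^sub>R Y p + f p *\<^sub>R D X Y p"
  using assms unfolding affine_connection_on_def by blast

lemma deriv_along_locally_const:
  assumes "open S" "p \<in> S" "\<And>q. q \<in> S \<Longrightarrow> f q = c"
  shows "deriv_along X f p = 0"
  unfolding deriv_along_def using frechet_derivative_cong_open[of S p f "\<lambda>_. c"] assms by simp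

text \<open>The difference of two fields agreeing on \<open>S\<close> is its own multiple by the function that is
  \<open>0\<close> on \<open>S\<close> and \<open>1\<close> elsewhere, and this function is smooth on \<open>S\<close>.\<close>

lemma affine_connection_on_cong:
  assumes conn: "affine_connection_on S D" and S: "open S"
    and X: "smooth_on S X" "\<And>q. q \<in> S \<Longrightarrow> X q = X' q"
    and Y: "smooth_on S Y" "\<And>q. q \<in> S \<Longrightarrow> Y q = Y' q"
    and p: "p \<in> S"
  shows "D X Y p = D X' Y' p"
proof -
  define f where "f = (\<lambda>q. if q \<in> S then 0 else 1::real)"
  have f: "smooth_on S f"
    by (rule smooth_on_cong[OF smooth_on_const S]) (simp add: f_def)
  have f0: "f p = 0" "deriv_along W f p = 0" for W
    using deriv_along_locally_const[OF S p, of f 0] p by (simp_all add: f_def)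
  define Z where "Z = (\<lambda>q. f q *\<^sub>R (X q - X' q))"
  define W where "W = (\<lambda>q. f q *\<^sub>R (Y q - Y' q))"
  have Z: "smooth_on S Z" and W: "smooth_on S W"
    by (rule smooth_on_cong[OF smooth_on_const S]; simp add: f_def Z_def W_def)+
  have X': "smooth_on S X'" and Y': "smooth_on S Y'"
    using smooth_on_cong S X Y by blast+
  have "(\<lambda>q. f q *\<^sub>R Z q) = Z" "(\<lambda>q. f q *\<^sub>R W q) = W"
    by (auto simp: Z_def W_def f_def)
  then have Z0: "D Z Y p = 0" and W0: "D X' W p = 0"
    using affine_connection_on_scale_left[OF conn f Z Y(1) p]
      affine_connection_on_scale_right[OF conn f X' W p] f0 by simp_all
  \<comment> \<open>Outside \<open>S\<close> the factor \<open>f\<close> is 1, so these are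
    equalities on the whole space and additivity of \<open>D\<close> applies to the right-hand
    sides.\<close>
  have "X = (\<lambda>q. X' q + Z q)" "Y = (\<lambda>q. Y' q + W q)"
    using X(2) Y(2) by (auto simp: Z_def W_def f_def)
  then have "D X Y p = D X' Y p + D Z Y p" "D X' Y p = D X' Y' p + D X' W p"
    using conn X' Y' Z W X(1) Y(1) p unfolding affine_connection_on_def by metis+
  then show ?thesis
    by (simp add: Z0 W0)
qed

text \<open>Compatibility with the metric expands the three derivatives, vanishing torsion the three
  brackets. By symmetry of \<open>g p\<close> everything cancels except two copies of the term with
  \<open>D X Y\<close>.\<close>

lemma koszul_formula:
  assumes lc: "levi_civita_connection_on S g D" and "bilinear (g p)"
    and sym: "\<And>u w. g p u w = g p w u"
    and XYZ: "smooth_on S X" "smooth_on S Y" "smooth_on S Z" and p: "p \<in> S"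
  shows "2 * g p (D X Y p) (Z p) =
    deriv_along X (\<lambda>q. g q (Y q) (Z q)) p + deriv_along Y (\<lambda>q. g q (Z q) (X q)) p -
    deriv_along Z (\<lambda>q. g q (X q) (Y q)) p +
    g p (lie_bracket X Y p) (Z p) - g p (lie_bracket Y Z p) (X p) + g p (lie_bracket Z X p) (Y p)"
proof -
  have bracket: "lie_bracket A B p = D A B p - D B A p"
    if "smooth_on S A" "smooth_on S B" for A B
    using lc p that unfolding levi_civita_connection_on_def by simp
  have compat: "deriv_along A (\<lambda>q. g q (B q) (C q)) p = g p (D A B p) (C p) + g p (D A C p) (B p)"
    if "smooth_on S A" "smooth_on S B" "smooth_on S C" for A B C
    using lc p that sym unfolding levi_civita_connection_on_def by simp
  have diff: "g p (a - b) c = g p a c - g p b c" for a b c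
    using bilinear_lsub[OF assms(2)] .
  show ?thesis
    using XYZ by (simp add: bracket compat diff)
qed

subsection \<open>The frame\<close>

lemma bilinear_metric3: "bilinear (metric3 f1 f2 p)"
  unfolding bilinear_def metric3_def
  by (auto intro!: linearI simp: algebra_simps add_divide_distrib)

lemma metric3_commute: "metric3 f1 f2 p u w = metric3 f1 f2 p w u"
  by (simp add: metric3_def mult.commute)

lemma metric3_frame3:
  assumes "f1 p \<noteq> 0" "f2 p \<noteq> 0"
  shows "metric3 f1 f2 p (frame3 f1 f2 i p) (frame3 f1 f2 j p) = (if i = j then 1 else 0)"
  using assms exhaust_3[of i] exhaust_3[of j]
  by (auto simp: metric3_def frame3_def axis_def power2_eq_square)

lemma frame3_expansion:
  assumes "f1 p \<noteq> 0" "f2 p \<noteq> 0"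
  shows "u = (\<Sum>k\<in>UNIV. metric3 f1 f2 p u (frame3 f1 f2 k p) *\<^sub>R frame3 f1 f2 k p)"
  using assms
  by (simp add: vec_eq_iff forall_3 sum_3 metric3_def frame3_def axis_def power2_eq_square)

lemma open_box3:
  assumes "open I1" "open I2" "open I3"
  shows "open (box3 I1 I2 I3)"
proof -
  have "box3 I1 I2 I3 = (\<lambda>p. p $ 1) -` I1 \<inter> (\<lambda>p. p $ 2) -` I2 \<inter> (\<lambda>p. p $ 3) -` I3"
    by (auto simp: box3_def)
  then show ?thesis
    using assms by (simp add: open_Int open_vimage_vec_nth)
qed

subsection \<open>The connection and the Ricci tensor in the frame\<close>

text \<open>\<phi>1 and \<phi>2 are tied to \<open>f1\<close> and \<open>f2\<close> only over the
  box and are not assumed differentiable; their derivatives are recovered from the smoothness of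
  \<open>f1\<close> and \<open>f2\<close>.\<close>

locale product_metric =
  fixes I1 I2 I3 :: "real set" and f1 f2 :: "real^3 \<Rightarrow> real" and \<phi>1 \<phi>2 :: "real \<Rightarrow> real"
    and D :: "(real^3 \<Rightarrow> real^3) \<Rightarrow> (real^3 \<Rightarrow> real^3) \<Rightarrow> real^3 \<Rightarrow> real^3"
  assumes open_intervals: "open I1" "open I2" "open I3"
    and smooth: "smooth_on (box3 I1 I2 I3) f1" "smooth_on (box3 I1 I2 I3) f2"
    and nonzero: "\<And>p. p \<in> box3 I1 I2 I3 \<Longrightarrow> f1 p \<noteq> 0"
      "\<And>p. p \<in> box3 I1 I2 I3 \<Longrightarrow> f2 p \<noteq> 0"
    and levi_civita: "levi_civita_connection_on (box3 I1 I2 I3) (metric3 f1 f2) D"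
    and f1_dep: "\<And>p. p \<in> box3 I1 I2 I3 \<Longrightarrow> f1 p = \<phi>1 (p $ 1)"
    and f2_dep: "\<And>p. p \<in> box3 I1 I2 I3 \<Longrightarrow> f2 p = \<phi>2 (p $ 3)"
begin

abbreviation I :: "(real^3) set" where "I \<equiv> box3 I1 I2 I3"
abbreviation g :: "real^3 \<Rightarrow> real^3 \<Rightarrow> real^3 \<Rightarrow> real" where "g \<equiv> metric3 f1 f2"
abbreviation E :: "3 \<Rightarrow> real^3 \<Rightarrow> real^3" where "E \<equiv> frame3 f1 f2"

definition d :: "real \<Rightarrow> real" where "d t = deriv \<phi>2 t / \<phi>2 t"

lemma open_I: "open I"
  using open_intervals by (rule open_box3)

lemma affine: "affine_connection_on I D"
  using levi_civita by (simp add: levi_civita_connection_on_def)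

section \<open>Derivatives of the frame fields in coordinates\<close>

lemma f2_has_derivative:
  assumes "p \<in> I"
  shows "(\<phi>2 has_real_derivative deriv \<phi>2 (p $ 3)) (at (p $ 3))"
    and "(f2 has_derivative (\<lambda>h. deriv \<phi>2 (p $ 3) * h $ 3)) (at p)"
  using function_of_one_coordinate[of I p f2 \<phi>2 3] open_I assms f2_dep
    smooth_on_imp_differentiable[OF smooth(2) assms] by blast+

lemma f1_has_derivative:
  assumes "p \<in> I"
  shows "(f1 has_derivative (\<lambda>h. deriv \<phi>1 (p $ 1) * h $ 1)) (at p)"
  using function_of_one_coordinate(2)[of I p f1 \<phi>1 1] open_I assms f1_dep
    smooth_on_imp_differentiable[OF smooth(1) assms] by blast

lemma g_E: "p \<in> I \<Longrightarrow> g p (E i p) (E j p) = (if i = j then 1 else 0)"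
  by (simp add: metric3_frame3 nonzero)

lemmas g_linear_simps =
  bilinear_ladd[OF bilinear_metric3] bilinear_lsub[OF bilinear_metric3]
  bilinear_lneg[OF bilinear_metric3] bilinear_lmul[OF bilinear_metric3]
  bilinear_lzero[OF bilinear_metric3]
  bilinear_radd[OF bilinear_metric3] bilinear_rsub[OF bilinear_metric3]
  bilinear_rneg[OF bilinear_metric3] bilinear_rmul[OF bilinear_metric3]
  bilinear_rzero[OF bilinear_metric3]

lemma deriv_along_g_E: "p \<in> I \<Longrightarrow> deriv_along X (\<lambda>q. g q (E i q) (E j q)) p = 0"
  by (rule deriv_along_locally_const[OF open_I]) (auto simp: g_E)

lemma smooth_on_E: "smooth_on I (E k)"
proof -
  have "smooth_on I (\<lambda>p. f1 p *\<^sub>R axis 1 1 :: real^3)" "smooth_on I (\<lambda>p. f2 p *\<^sub>R axis 2 1 :: real^3)"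
    by (rule smooth_on_bounded_linear[OF smooth(1) bounded_linear_scaleR_left open_I]
        smooth_on_bounded_linear[OF smooth(2) bounded_linear_scaleR_left open_I])+
  then show ?thesis
    using exhaust_3[of k] by (auto simp: frame3_def[abs_def] smooth_on_const)
qed

definition E' :: "3 \<Rightarrow> real^3 \<Rightarrow> real^3 \<Rightarrow> real^3" where
  "E' k p h = (if k = 1 then (deriv \<phi>1 (p $ 1) * h $ 1) *\<^sub>R axis 1 1
    else if k = 2 then (deriv \<phi>2 (p $ 3) * h $ 3) *\<^sub>R axis 2 1 else 0)"

lemma E_has_derivative:
  assumes "p \<in> I"
  shows "(E k has_derivative E' k p) (at p)"
  using bounded_linear.has_derivative[OF bounded_linear_scaleR_left f1_has_derivative[OF assms]]
    bounded_linear.has_derivative[OF bounded_linear_scaleR_left f2_has_derivative(2)[OF assms]]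
  using exhaust_3[of k] by (auto simp: E'_def[abs_def] frame3_def[abs_def])

lemma frechet_derivative_E: "p \<in> I \<Longrightarrow> frechet_derivative (E k) (at p) = E' k p"
  using frechet_derivative_at[OF E_has_derivative] by simp

lemma E_eq:
  "E 1 p = f1 p *\<^sub>R axis 1 1" "E 2 p = f2 p *\<^sub>R axis 2 1" "E 3 p = axis 3 1"
  by (simp_all add: frame3_def)

text \<open>By definition of \<open>d\<close>, the derivative of \<open>f2\<close> along
  \<open>E 3\<close> is \<open>d\<close> times \<open>f2\<close>, which gives the multiple of
  \<open>E 2\<close>. The \<phi>1 term arises only for \<open>E 1\<close> along itself and drops out
  of every bracket.\<close>

lemma E'_E:
  assumes "p \<in> I"
  shows "E' i p (E j p) = (if i = 1 \<and> j = 1 then deriv \<phi>1 (p $ 1) *\<^sub>R E 1 p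
    else if i = 2 \<and> j = 3 then d (p $ 3) *\<^sub>R E 2 p else 0)"
proof -
  have "\<phi>2 (p $ 3) \<noteq> 0"
    using nonzero f2_dep assms by metis
  then show ?thesis
    using exhaust_3[of i] exhaust_3[of j] assms
    by (auto simp: E'_def E_eq d_def f2_dep axis_def)
qed

section \<open>Brackets and covariant derivatives of the frame fields\<close>

definition bracket_coeff :: "3 \<Rightarrow> 3 \<Rightarrow> real" where
  "bracket_coeff i j = (if i = 2 \<and> j = 3 then -1 else if i = 3 \<and> j = 2 then 1 else 0)"

lemma lie_bracket_E:
  assumes "p \<in> I"
  shows "lie_bracket (E i) (E j) p = (bracket_coeff i j * d (p $ 3)) *\<^sub>R E 2 p"
  using exhaust_3[of i] exhaust_3[of j] assms
  by (auto simp: lie_bracket_def frechet_derivative_E E'_E bracket_coeff_def)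

definition conn_coeff :: "3 \<Rightarrow> 3 \<Rightarrow> real" where
  "conn_coeff i j = (if i = 2 \<and> j = 2 then 1 else if i = 2 \<and> j = 3 then -1 else 0)"

text \<open>Each \<open>D (E i) (E j)\<close> is a multiple of one frame field, whose index can be
  taken to depend on \<open>j\<close> alone; this makes covariant derivatives easy to iterate. The
  value 2 at \<open>j = 1\<close> is arbitrary, because \<open>conn_coeff i 1 = 0\<close>.\<close>

definition conn_index :: "3 \<Rightarrow> 3" where
  "conn_index j = (if j = 2 then 3 else 2)"

text \<open>Inner products of frame fields are constant, so only the bracket terms of Koszul's
  formula survive. They give the components of \<open>D (E i) (E j)\<close>, which the orthonormal
  expansion reassembles.\<close>

lemma D_E:
  assumes "p \<in> I"
  shows "D (E i) (E j) p = (conn_coeff i j * d (p $ 3)) *\<^sub>R E (conn_index j) p"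
proof -
  have koszul: "2 * g p (D (E i) (E j) p) (E k p) =
      (bracket_coeff i j * (if k = 2 then 1 else 0) - bracket_coeff j k * (if i = 2 then 1 else 0)
       + bracket_coeff k i * (if j = 2 then 1 else 0)) * d (p $ 3)" for k
    using koszul_formula[OF levi_civita bilinear_metric3 metric3_commute
        smooth_on_E smooth_on_E smooth_on_E assms, of i j k] assms
    by (simp add: deriv_along_g_E lie_bracket_E g_linear_simps g_E algebra_simps)
  have "g p (D (E i) (E j) p) (E k p) =
      (if k = conn_index j then conn_coeff i j * d (p $ 3) else 0)" for k
    using exhaust_3[of i] exhaust_3[of j] exhaust_3[of k] koszul[of k]
    by (elim disjE; simp add: bracket_coeff_def conn_coeff_def conn_index_def)
  then show ?thesis
    using frame3_expansion[of f1 p f2 "D (E i) (E j) p"] nonzero assms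
    by (simp add: if_distrib[of "\<lambda>c. c *\<^sub>R _"] sum.delta cong: if_cong)
qed

text \<open>\<open>d\<close> is the third component of \<open>D (E 2) (E 2)\<close>, which equals
  \<open>d\<close> times \<open>E 3\<close> and is smooth by definition of a connection.\<close>

lemma smooth_on_d: "smooth_on I (\<lambda>p. d (p $ 3))"
proof (rule smooth_on_cong[OF _ open_I])
  show "smooth_on I (\<lambda>p. D (E 2) (E 2) p $ 3)"
    by (rule smooth_on_bounded_linear[OF affine_connection_on_smooth[OF affine smooth_on_E smooth_on_E]
        bounded_linear_vec_nth open_I])
qed (simp add: D_E conn_coeff_def conn_index_def E_eq)

lemma smooth_on_scale_d: "smooth_on I (\<lambda>p. c * d (p $ 3))"
  by (rule smooth_on_bounded_linear[OF smooth_on_d bounded_linear_mult_right open_I])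

lemma d_has_derivative:
  assumes "p \<in> I"
  shows "(d has_real_derivative deriv d (p $ 3)) (at (p $ 3))"
    and "((\<lambda>q. d (q $ 3)) has_derivative (\<lambda>h. deriv d (p $ 3) * h $ 3)) (at p)"
  using function_of_one_coordinate[of I p "\<lambda>q. d (q $ 3)" d 3] open_I assms
    smooth_on_imp_differentiable[OF smooth_on_d assms] by blast+

section \<open>Second covariant derivatives and curvature\<close>

lemma deriv_along_scale_d:
  assumes "p \<in> I"
  shows "deriv_along X (\<lambda>q. c * d (q $ 3)) p = c * deriv d (p $ 3) * X p $ 3"
proof -
  have "((\<lambda>q. c * d (q $ 3)) has_derivative (\<lambda>h. c * (deriv d (p $ 3) * h $ 3))) (at p)"
    by (intro has_derivative_mult_right d_has_derivative assms)
  from fun_cong[OF frechet_derivative_at[OF this], of "X p"] show ?thesis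
    by (simp add: deriv_along_def)
qed

text \<open>The inner derivative is known only on the box. Locality of \<open>D\<close> permits
  replacing it by its frame expression, to which the Leibniz rule applies.\<close>

lemma D_E_D_E:
  assumes "p \<in> I"
  shows "D (E l) (D (E i) (E j)) p = conn_coeff i j *\<^sub>R
    ((deriv d (p $ 3) * E l p $ 3) *\<^sub>R E (conn_index j) p
     + (conn_coeff l (conn_index j) * (d (p $ 3))\<^sup>2) *\<^sub>R E (conn_index (conn_index j)) p)"
proof -
  have "D (E l) (D (E i) (E j)) p =
      D (E l) (\<lambda>q. (conn_coeff i j * d (q $ 3)) *\<^sub>R E (conn_index j) q) p"
    by (rule affine_connection_on_cong[OF affine open_I])
      (simp_all add: smooth_on_E affine_connection_on_smooth[OF affine] D_E assms)
  also have "\<dots> = deriv_along (E l) (\<lambda>q. conn_coeff i j * d (q $ 3)) p *\<^sub>R E (conn_index j) p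
      + (conn_coeff i j * d (p $ 3)) *\<^sub>R D (E l) (E (conn_index j)) p"
    by (rule affine_connection_on_scale_right[OF affine smooth_on_scale_d smooth_on_E smooth_on_E assms])
  finally show ?thesis
    by (simp add: deriv_along_scale_d D_E assms power2_eq_square algebra_simps)
qed

text \<open>All brackets are constant multiples of \<open>D (E 2) (E 3)\<close>, which is
  \<open>- d\<close> times \<open>E 2\<close>. Smoothness is what allows a bracket to be used as an
  argument of \<open>D\<close>.\<close>

lemma smooth_on_lie_bracket_E: "smooth_on I (lie_bracket (E i) (E j))"
proof (rule smooth_on_cong[OF _ open_I])
  show "smooth_on I (\<lambda>p. - bracket_coeff i j *\<^sub>R D (E 2) (E 3) p)"
    by (rule smooth_on_bounded_linear[OF affine_connection_on_smooth[OF affine smooth_on_E smooth_on_E]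
        bounded_linear_scaleR_right open_I])
qed (simp add: lie_bracket_E D_E conn_coeff_def conn_index_def)

lemma D_lie_bracket_E:
  assumes "p \<in> I"
  shows "D (lie_bracket (E i) (E j)) (E k) p =
    (bracket_coeff i j * conn_coeff 2 k * (d (p $ 3))\<^sup>2) *\<^sub>R E (conn_index k) p"
proof -
  have "D (lie_bracket (E i) (E j)) (E k) p =
      D (\<lambda>q. (bracket_coeff i j * d (q $ 3)) *\<^sub>R E 2 q) (E k) p"
    by (rule affine_connection_on_cong[OF affine open_I])
      (simp_all add: smooth_on_E smooth_on_lie_bracket_E lie_bracket_E assms)
  also have "\<dots> = (bracket_coeff i j * d (p $ 3)) *\<^sub>R D (E 2) (E k) p"
    by (rule affine_connection_on_scale_left[OF affine smooth_on_scale_d smooth_on_E smooth_on_E assms])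
  finally show ?thesis
    by (simp add: D_E assms power2_eq_square)
qed

text \<open>\<open>E 1\<close> is parallel, so the metric is locally a product of a line and a
  surface. The Ricci tensor is the Gaussian curvature \<open>d' - d^2\<close> of the surface on the
  span of \<open>E 2\<close> and \<open>E 3\<close>, and zero on the remaining components.\<close>

lemma ricci_E:
  assumes "p \<in> I"
  shows "ricci g D E (E i) (E j) p =
    (if i = j \<and> i \<noteq> 1 then deriv d (p $ 3) - (d (p $ 3))\<^sup>2 else 0)"
proof -
  \<comment> \<open>Since \<open>d\<close> depends on the third coordinate alone, only derivatives
    along \<open>E 3\<close> produce \<open>d'\<close>.\<close>
  have E3: "E k p $ 3 = (if k = 3 then 1 else 0)" for k
    using exhaust_3[of k] by (auto simp: E_eq axis_def)
  show ?thesis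
    unfolding ricci_def curvature_def sum_3 D_E_D_E[OF assms] D_lie_bracket_E[OF assms] E3
    using exhaust_3[of i] exhaust_3[of j]
    by (auto simp: g_linear_simps g_E[OF assms] conn_coeff_def conn_index_def bracket_coeff_def
        algebra_simps)
qed

end

subsection \<open>The soliton equations\<close>

locale product_soliton = product_metric +
  fixes V :: "3 \<Rightarrow> real^3 \<Rightarrow> real" and v :: "3 \<Rightarrow> real \<Rightarrow> real" and lam \<mu> :: "real^3 \<Rightarrow> real"
  assumes soliton: "almost_eta_ricci_soliton (box3 I1 I2 I3) (metric3 f1 f2) D (frame3 f1 f2) dx3
      (\<lambda>p. \<Sum>k\<in>UNIV. V k p *\<^sub>R frame3 f1 f2 k p) lam \<mu>"
    and V_dep: "\<And>k p. p \<in> box3 I1 I2 I3 \<Longrightarrow> V k p = v k (p $ 3)"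
begin

abbreviation W :: "real^3 \<Rightarrow> real^3" where "W p \<equiv> \<Sum>k\<in>UNIV. V k p *\<^sub>R E k p"

text \<open>The soliton condition makes the field \<open>W\<close> smooth, not its coefficients.
  Each \<open>V k\<close> is recovered on the box as a component of \<open>W\<close> divided by the
  nonzero diagonal component of \<open>E k\<close>.\<close>

lemma V_has_derivative:
  assumes "p \<in> I"
  shows "(v k has_real_derivative deriv (v k) (p $ 3)) (at (p $ 3))"
    and "(V k has_derivative (\<lambda>h. deriv (v k) (p $ 3) * h $ 3)) (at p)"
proof -
  have comp: "W q $ k = V k q * E k q $ k" for q
    using exhaust_3[of k] by (auto simp: sum_3 E_eq axis_def)
  have nz: "E k q $ k \<noteq> 0" if "q \<in> I" for q
    using exhaust_3[of k] nonzero[OF that] by (auto simp: E_eq)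
  have "smooth_on I W"
    using soliton by (simp add: almost_eta_ricci_soliton_def)
  then have "smooth_on I (\<lambda>q. W q $ k)"
    by (rule smooth_on_bounded_linear[OF _ bounded_linear_vec_nth open_I])
  moreover have "smooth_on I (\<lambda>q. E k q $ k)"
    by (rule smooth_on_bounded_linear[OF smooth_on_E bounded_linear_vec_nth open_I])
  ultimately have "(\<lambda>q. W q $ k / E k q $ k) differentiable (at p)"
    using nz[OF assms] assms by (intro differentiable_divide smooth_on_imp_differentiable)
  then have "V k differentiable (at p)"
    by (rule differentiable_cong_open[OF _ open_I assms]) (use nz comp in simp)
  then show "(v k has_real_derivative deriv (v k) (p $ 3)) (at (p $ 3))"
    and "(V k has_derivative (\<lambda>h. deriv (v k) (p $ 3) * h $ 3)) (at p)"
    using function_of_one_coordinate[of I p "V k" "v k" 3] open_I assms V_dep by blast+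
qed

lemma W_has_derivative:
  assumes "p \<in> I"
  shows "(W has_derivative (\<lambda>h. \<Sum>k\<in>UNIV. V k p *\<^sub>R E' k p h + (deriv (v k) (p $ 3) * h $ 3) *\<^sub>R E k p))
    (at p)"
  by (intro has_derivative_sum has_derivative_scaleR V_has_derivative E_has_derivative assms)

text \<open>The bracket is the sum over \<open>k\<close> of \<open>V k\<close> times the bracket of
  \<open>E k\<close> and \<open>E j\<close>, minus the derivative of \<open>V k\<close> along
  \<open>E j\<close> times \<open>E k\<close>. The latter is nonzero at most for
  \<open>j = 3\<close>, as the coefficients depend on the third coordinate only.\<close>

lemma lie_bracket_W_E:
  assumes "p \<in> I"
  shows "lie_bracket W (E j) p =
    (if j = 2 then (V 3 p * d (p $ 3)) *\<^sub>R E 2 p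
     else if j = 3 then - (V 2 p * d (p $ 3)) *\<^sub>R E 2 p - (\<Sum>k\<in>UNIV. deriv (v k) (p $ 3) *\<^sub>R E k p)
     else 0)"
proof -
  have lin: "E' j p (W p) = (\<Sum>k\<in>UNIV. V k p *\<^sub>R E' j p (E k p))"
    using has_derivative_linear[OF E_has_derivative[OF assms]]
    by (simp add: linear_sum linear_scale)
  have E3: "E k p $ 3 = (if k = 3 then 1 else 0)" for k
    using exhaust_3[of k] by (auto simp: E_eq axis_def)
  have bracket: "lie_bracket W (E j) p = (\<Sum>k\<in>UNIV. V k p *\<^sub>R E' j p (E k p))
      - (\<Sum>k\<in>UNIV. V k p *\<^sub>R E' k p (E j p) + (deriv (v k) (p $ 3) * E j p $ 3) *\<^sub>R E k p)"
    using frechet_derivative_at[OF W_has_derivative[OF assms]]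
    by (simp only: lie_bracket_def frechet_derivative_E[OF assms] lin fun_eq_iff)
  show ?thesis
    unfolding bracket using exhaust_3[of j] by (auto simp: sum_3 E'_E[OF assms] E3 algebra_simps)
qed

text \<open>Since \<open>g\<close> is constant on pairs of frame fields, the Lie derivative reduces
  to its two bracket terms; \<open>dx3\<close> detects only \<open>E 3\<close>.\<close>

lemma frame_equation:
  assumes "p \<in> I"
  shows "1 / 2 * (- g p (lie_bracket W (E i) p) (E j p) - g p (E i p) (lie_bracket W (E j) p))
      + ricci g D E (E i) (E j) p
      + (if i = j then lam p else 0) + (if i = 3 \<and> j = 3 then \<mu> p else 0) = 0"
proof -
  have "1 / 2 * lie_deriv_metric W g (E i) (E j) p + ricci g D E (E i) (E j) p
      + lam p * g p (E i p) (E j p) + \<mu> p * (dx3 p (E i p) * dx3 p (E j p)) = 0"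
    using soliton assms smooth_on_E unfolding almost_eta_ricci_soliton_def by blast
  moreover have "dx3 p (E k p) = (if k = 3 then 1 else 0)" for k
    using exhaust_3[of k] by (auto simp: dx3_def E_eq axis_def)
  ultimately show ?thesis
    by (simp add: lie_deriv_metric_def deriv_along_g_E g_E assms split: if_splits)
qed

lemma soliton_equations:
  assumes "p \<in> I"
  shows "lam p = 0"
    and "deriv (v 1) (p $ 3) = 0"
    and "deriv (v 2) (p $ 3) + d (p $ 3) * v 2 (p $ 3) = 0"
    and "d (p $ 3) * v 3 (p $ 3) = deriv d (p $ 3) - (d (p $ 3))\<^sup>2"
    and "\<mu> p = - deriv (v 3) (p $ 3) - (deriv d (p $ 3) - (d (p $ 3))\<^sup>2)"
proof -
  note eq = frame_equation[OF assms, unfolded lie_bracket_W_E[OF assms] ricci_E[OF assms]]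
  note simps = sum_3 g_linear_simps g_E[OF assms] V_dep[OF assms]
  show lam: "lam p = 0"
    using eq[of 1 1] by (simp add: simps)
  show "deriv (v 1) (p $ 3) = 0"
    using eq[of 1 3] by (simp add: simps)
  show "deriv (v 2) (p $ 3) + d (p $ 3) * v 2 (p $ 3) = 0"
    using eq[of 2 3] by (simp add: simps algebra_simps)
  show "d (p $ 3) * v 3 (p $ 3) = deriv d (p $ 3) - (d (p $ 3))\<^sup>2"
    using eq[of 2 2] by (simp add: simps lam algebra_simps)
  show "\<mu> p = - deriv (v 3) (p $ 3) - (deriv d (p $ 3) - (d (p $ 3))\<^sup>2)"
    using eq[of 3 3] by (simp add: simps lam algebra_simps)
qed

text \<open>The box is nonempty because \<mu> is nonzero somewhere, and the third coordinate of a
  point in it can be moved freely within \<open>I3\<close>. Equations at points of the box thereby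
  become equations in one variable on all of \<open>I3\<close>.\<close>

lemma exists_point_at_height:
  assumes "t \<in> I3"
  obtains p where "p \<in> I" "p $ 3 = t"
proof -
  obtain q where "q \<in> I"
    using soliton unfolding almost_eta_ricci_soliton_def by blast
  then have "vector [q $ 1, q $ 2, t] \<in> I"
    using assms by (simp add: box3_def)
  then show thesis
    by (rule that) simp
qed

text \<open>The constants are \<open>v 1\<close> and the product of \<phi>2 and \<open>v 2\<close>.
  The derivative of that product is \<phi>2 times the left-hand side of the third soliton equation,
  hence zero, and \<open>I3\<close> is convex.\<close>

lemma V1_V2:
  assumes "convex I3"
  obtains c1 c2 where "\<And>p. p \<in> I \<Longrightarrow> V 1 p = c1" "\<And>p. p \<in> I \<Longrightarrow> V 2 p = c2 / f2 p"
proof -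
  have "(v 1 has_real_derivative 0) (at t within I3)" if "t \<in> I3" for t
  proof -
    obtain p where p: "p \<in> I" "p $ 3 = t"
      using exists_point_at_height \<open>t \<in> I3\<close> .
    show ?thesis
      using V_has_derivative(1)[OF p(1), of 1] soliton_equations(2)[OF p(1)]
      by (simp add: p(2) has_field_derivative_at_within)
  qed
  then have "\<exists>c. \<forall>t\<in>I3. v 1 t = c"
    by (rule has_field_derivative_zero_constant[OF assms])
  then obtain c1 where c1: "\<And>t. t \<in> I3 \<Longrightarrow> v 1 t = c1"
    by blast
  have "((\<lambda>t. \<phi>2 t * v 2 t) has_real_derivative 0) (at t within I3)" if "t \<in> I3" for t
  proof -
    obtain p where p: "p \<in> I" "p $ 3 = t"
      using exists_point_at_height \<open>t \<in> I3\<close> .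
    have nz: "\<phi>2 t \<noteq> 0"
      using nonzero(2) f2_dep p by metis
    have "((\<lambda>t. \<phi>2 t * v 2 t) has_real_derivative deriv \<phi>2 t * v 2 t + deriv (v 2) t * \<phi>2 t) (at t)"
      using f2_has_derivative(1)[OF p(1)] V_has_derivative(1)[OF p(1), of 2]
      unfolding p(2) by (rule DERIV_mult)
    moreover have "deriv \<phi>2 t * v 2 t + deriv (v 2) t * \<phi>2 t
        = \<phi>2 t * (deriv (v 2) t + d t * v 2 t)"
      using nz by (simp add: d_def field_simps)
    ultimately show ?thesis
      using soliton_equations(3)[OF p(1)] by (simp add: p(2) has_field_derivative_at_within)
  qed
  then have "\<exists>c. \<forall>t\<in>I3. \<phi>2 t * v 2 t = c"
    by (rule has_field_derivative_zero_constant[OF assms])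
  then obtain c2 where c2: "\<And>t. t \<in> I3 \<Longrightarrow> \<phi>2 t * v 2 t = c2"
    by blast
  show thesis
  proof
    fix p assume p: "p \<in> I"
    then have "p $ 3 \<in> I3"
      by (simp add: box3_def)
    then show "V 1 p = c1" "V 2 p = c2 / f2 p"
      using c1 c2[of "p $ 3"] nonzero(2)[OF p] by (auto simp: V_dep f2_dep p)
  qed
qed

text \<open>Differentiating \<open>d V\<^sup>3 = d' - d\<^sup>2\<close> shows in particular that \<open>d''\<close> exists.\<close>

lemma mu_equation:
  assumes "p \<in> I"
  shows "(d (p $ 3))\<^sup>2 * \<mu> p =
    (deriv d (p $ 3))\<^sup>2 + (d (p $ 3)) ^ 4 - d (p $ 3) * deriv (deriv d) (p $ 3)"
proof -
  define t where "t = p $ 3"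
  have "t \<in> I3"
    using assms by (simp add: t_def box3_def)
  have "((\<lambda>s. d s * v 3 s + (d s)\<^sup>2) has_real_derivative
      deriv d t * v 3 t + d t * deriv (v 3) t + 2 * d t * deriv d t) (at t)"
    using d_has_derivative(1)[OF assms] V_has_derivative(1)[OF assms, of 3] unfolding t_def
    by (auto intro!: derivative_eq_intros)
  then have "(deriv d has_real_derivative
      deriv d t * v 3 t + d t * deriv (v 3) t + 2 * d t * deriv d t) (at t)"
  proof (rule has_field_derivative_transform_within_open[OF _ open_intervals(3) \<open>t \<in> I3\<close>])
    show "d s * v 3 s + (d s)\<^sup>2 = deriv d s" if "s \<in> I3" for s
      using exists_point_at_height[OF that] soliton_equations(4) by force
  qed
  then have dd: "deriv (deriv d) t = deriv d t * v 3 t + d t * deriv (v 3) t + 2 * d t * deriv d t"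
    by (rule DERIV_imp_deriv)
  have dv: "d t * v 3 t = deriv d t - (d t)\<^sup>2"
    using soliton_equations(4)[OF assms] by (simp add: t_def)
  \<comment> \<open>After multiplication by \<open>d\<close>, \<open>v 3\<close> enters only through
    the known product \<open>d * v 3\<close>, and \<open>d^2\<close> times the derivative of
    \<open>v 3\<close> is eliminated using the formula for \<mu>. Nothing is divided by
    \<open>d\<close>, which may vanish.\<close>
  have "d t * deriv (deriv d) t
      = deriv d t * (d t * v 3 t) + (d t)\<^sup>2 * deriv (v 3) t + 2 * (d t)\<^sup>2 * deriv d t"
    by (simp add: dd algebra_simps power2_eq_square)
  then show ?thesis
    unfolding soliton_equations(5)[OF assms] t_def[symmetric] dv by algebra
qed

end

subsection \<open>The classification\<close>

theorem theorem3p15: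
  fixes I1 I2 I3 :: "real set" and I :: "(real^3) set"
    and f1 f2 :: "real^3 \<Rightarrow> real" and \<phi>1 \<phi>2 d :: "real \<Rightarrow> real"
    and V :: "3 \<Rightarrow> real^3 \<Rightarrow> real" and v :: "3 \<Rightarrow> real \<Rightarrow> real"
    and lam \<mu> :: "real^3 \<Rightarrow> real"
    and D :: "(real^3 \<Rightarrow> real^3) \<Rightarrow> (real^3 \<Rightarrow> real^3) \<Rightarrow> real^3 \<Rightarrow> real^3"
  defines "I \<equiv> box3 I1 I2 I3"
    and "d \<equiv> (\<lambda>t. deriv \<phi>2 t / \<phi>2 t)"
  assumes intervals: "open I1" "is_interval I1" "open I2" "is_interval I2"
      "open I3" "is_interval I3"
    and smooth: "smooth_on I f1" "smooth_on I f2"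
    and nonzero: "\<And>p. p \<in> I \<Longrightarrow> f1 p \<noteq> 0" "\<And>p. p \<in> I \<Longrightarrow> f2 p \<noteq> 0"
    and levi_civita: "levi_civita_connection_on I (metric3 f1 f2) D"
    and soliton: "almost_eta_ricci_soliton I (metric3 f1 f2) D (frame3 f1 f2) dx3
        (\<lambda>p. \<Sum>k\<in>UNIV. V k p *\<^sub>R frame3 f1 f2 k p) lam \<mu>"
    and f1_dep: "\<And>p. p \<in> I \<Longrightarrow> f1 p = \<phi>1 (p $ 1)"
    and f2_dep: "\<And>p. p \<in> I \<Longrightarrow> f2 p = \<phi>2 (p $ 3)"
    and V_dep: "\<And>k p. p \<in> I \<Longrightarrow> V k p = v k (p $ 3)"
  shows "(\<exists>c1 c2 :: real. \<forall>p\<in>I.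
            V 1 p = c1 \<and>
            V 2 p = c2 / f2 p \<and>
            d (p $ 3) * V 3 p = deriv d (p $ 3) - (d (p $ 3))\<^sup>2 \<and>
            lam p = 0 \<and>
            (d (p $ 3))\<^sup>2 * \<mu> p =
              (deriv d (p $ 3))\<^sup>2 + (d (p $ 3)) ^ 4 - d (p $ 3) * deriv (deriv d) (p $ 3)) \<and>
         (\<forall>J3. open J3 \<and> is_interval J3 \<and> J3 \<subseteq> I3 \<and> (\<exists>c. \<forall>t\<in>J3. \<phi>2 t = c) \<longrightarrow>
            (\<exists>(c1 :: real) (c2 :: real) (F :: real \<Rightarrow> real). \<forall>p\<in>box3 I1 I2 J3.
               V 1 p = c1 \<and>
               V 2 p = c2 \<and>
               V 3 p = F (p $ 3) \<and>
               lam p = 0 \<and>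
               (F has_real_derivative - \<mu> p) (at (p $ 3)))) \<and>
         (\<forall>J3. open J3 \<and> is_interval J3 \<and> J3 \<subseteq> I3 \<longrightarrow>
            ((\<forall>t\<in>J3. deriv \<phi>2 t \<noteq> 0) \<longleftrightarrow> (\<forall>t\<in>J3. d t \<noteq> 0)) \<and>
            ((\<forall>t\<in>J3. deriv \<phi>2 t \<noteq> 0) \<longrightarrow>
              (\<exists>c1 c2 :: real. \<forall>p\<in>box3 I1 I2 J3.
                 V 1 p = c1 \<and>
                 V 2 p = c2 / f2 p \<and>
                 V 3 p = (deriv d (p $ 3) - (d (p $ 3))\<^sup>2) / d (p $ 3) \<and>
                 lam p = 0 \<and>
                 \<mu> p = - deriv (deriv d) (p $ 3) / d (p $ 3)
                       + (deriv d (p $ 3) / d (p $ 3))\<^sup>2 + (d (p $ 3))\<^sup>2)))"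
proof -
  interpret S: product_soliton I1 I2 I3 f1 f2 \<phi>1 \<phi>2 D V v lam \<mu>
    by unfold_locales (use assms in \<open>simp_all add: I_def\<close>)
  have d: "S.d = d"
    by (simp add: S.d_def d_def fun_eq_iff)
  note eqs = S.soliton_equations[unfolded d, folded I_def]
    and mu = S.mu_equation[unfolded d, folded I_def]
  have \<phi>2: "\<phi>2 t \<noteq> 0" if "t \<in> I3" for t
    using S.exists_point_at_height[OF that] nonzero(2) f2_dep I_def by metis
  have "convex I3"
    using intervals by (simp add: is_interval_convex)
  then obtain c1 c2 where c: "\<And>p. p \<in> I \<Longrightarrow> V 1 p = c1" "\<And>p. p \<in> I \<Longrightarrow> V 2 p = c2 / f2 p"
    using S.V1_V2 unfolding I_def by metis
  have all: "\<forall>p\<in>I. V 1 p = c1 \<and> V 2 p = c2 / f2 p \<and>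
      d (p $ 3) * V 3 p = deriv d (p $ 3) - (d (p $ 3))\<^sup>2 \<and> lam p = 0 \<and>
      (d (p $ 3))\<^sup>2 * \<mu> p =
        (deriv d (p $ 3))\<^sup>2 + (d (p $ 3)) ^ 4 - d (p $ 3) * deriv (deriv d) (p $ 3)"
    using c eqs mu V_dep by simp
  have flat: "\<exists>c1 c2 F. \<forall>p\<in>box3 I1 I2 J3. V 1 p = c1 \<and> V 2 p = c2 \<and> V 3 p = F (p $ 3) \<and>
      lam p = 0 \<and> (F has_real_derivative - \<mu> p) (at (p $ 3))"
    if J3: "open J3" "J3 \<subseteq> I3" and const: "\<And>t. t \<in> J3 \<Longrightarrow> \<phi>2 t = k" for J3 k
  \<comment> \<open>The witnesses are \<open>c1\<close>, \<open>c2 / k\<close> and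
    \<open>v 3\<close>, because \<open>f2\<close> has the value \<open>k\<close> over
    \<open>J3\<close>.\<close>
  proof (intro exI ballI conjI)
    fix p assume "p \<in> box3 I1 I2 J3"
    then have p: "p \<in> I" "p $ 3 \<in> J3"
      using J3 by (auto simp: I_def box3_def)
    show "V 1 p = c1" "V 2 p = c2 / k" "V 3 p = v 3 (p $ 3)" "lam p = 0"
      using c eqs(1) V_dep f2_dep const p by auto
    have "(\<phi>2 has_real_derivative 0) (at (p $ 3))"
      by (rule has_field_derivative_transform_within_open[OF DERIV_const J3(1) p(2)])
        (simp add: const)
    then have "d (p $ 3) = 0"
      by (simp add: d_def DERIV_imp_deriv)
    \<comment> \<open>At \<open>d = 0\<close> the equation \<open>d V^3 = d' - d^2\<close> forces
      \<open>d' = 0\<close>, so the curvature term in the formula for \<mu> disappears.\<close>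
    then have "\<mu> p = - deriv (v 3) (p $ 3)"
      using eqs(4,5)[OF p(1)] by simp
    then show "(v 3 has_real_derivative - \<mu> p) (at (p $ 3))"
      using S.V_has_derivative(1)[folded I_def, OF p(1), of 3] by simp
  qed
  have iff: "(\<forall>t\<in>J3. deriv \<phi>2 t \<noteq> 0) \<longleftrightarrow> (\<forall>t\<in>J3. d t \<noteq> 0)" if "J3 \<subseteq> I3" for J3
    using that \<phi>2 by (auto simp: d_def)
  have curved: "\<forall>p\<in>box3 I1 I2 J3. V 1 p = c1 \<and> V 2 p = c2 / f2 p \<and>
      V 3 p = (deriv d (p $ 3) - (d (p $ 3))\<^sup>2) / d (p $ 3) \<and> lam p = 0 \<and>
      \<mu> p = - deriv (deriv d) (p $ 3) / d (p $ 3)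
        + (deriv d (p $ 3) / d (p $ 3))\<^sup>2 + (d (p $ 3))\<^sup>2"
    if "J3 \<subseteq> I3" and nz: "\<forall>t\<in>J3. d t \<noteq> 0" for J3
  proof (intro ballI conjI)
    fix p assume "p \<in> box3 I1 I2 J3"
    then have p: "p \<in> I" and d0: "d (p $ 3) \<noteq> 0"
      using that by (auto simp: I_def box3_def)
    show "V 1 p = c1" "V 2 p = c2 / f2 p" "lam p = 0"
      using c eqs(1) p by auto
    show "V 3 p = (deriv d (p $ 3) - (d (p $ 3))\<^sup>2) / d (p $ 3)"
      using eqs(4)[OF p] V_dep[OF p] d0 by (simp add: eq_divide_eq mult.commute)
    have "\<mu> p = ((deriv d (p $ 3))\<^sup>2 + (d (p $ 3)) ^ 4 - d (p $ 3) * deriv (deriv d) (p $ 3))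
        / (d (p $ 3))\<^sup>2"
      using mu[OF p] d0 by (simp add: eq_divide_eq mult.commute)
    also have "\<dots> = - deriv (deriv d) (p $ 3) / d (p $ 3)
        + (deriv d (p $ 3) / d (p $ 3))\<^sup>2 + (d (p $ 3))\<^sup>2"
      using d0 by (simp add: field_simps power2_eq_square power4_eq_xxxx)
    finally show "\<mu> p = - deriv (deriv d) (p $ 3) / d (p $ 3)
        + (deriv d (p $ 3) / d (p $ 3))\<^sup>2 + (d (p $ 3))\<^sup>2" .
  qed
  show ?thesis
  proof (intro conjI allI impI)
    show "\<exists>c1 c2. \<forall>p\<in>I. V 1 p = c1 \<and> V 2 p = c2 / f2 p \<and>
        d (p $ 3) * V 3 p = deriv d (p $ 3) - (d (p $ 3))\<^sup>2 \<and> lam p = 0 \<and>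
        (d (p $ 3))\<^sup>2 * \<mu> p =
          (deriv d (p $ 3))\<^sup>2 + (d (p $ 3)) ^ 4 - d (p $ 3) * deriv (deriv d) (p $ 3)"
      using all by (intro exI)
  next
    fix J3 assume "open J3 \<and> is_interval J3 \<and> J3 \<subseteq> I3 \<and> (\<exists>c. \<forall>t\<in>J3. \<phi>2 t = c)"
    then show "\<exists>c1 c2 F. \<forall>p\<in>box3 I1 I2 J3. V 1 p = c1 \<and> V 2 p = c2 \<and> V 3 p = F (p $ 3) \<and>
        lam p = 0 \<and> (F has_real_derivative - \<mu> p) (at (p $ 3))"
      by (elim conjE exE) (rule flat; simp)
  next
    fix J3 assume J3: "open J3 \<and> is_interval J3 \<and> J3 \<subseteq> I3"
    then show "(\<forall>t\<in>J3. deriv \<phi>2 t \<noteq> 0) \<longleftrightarrow> (\<forall>t\<in>J3. d t \<noteq> 0)"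
      by (intro iff) simp
    assume "\<forall>t\<in>J3. deriv \<phi>2 t \<noteq> 0"
    then have "\<forall>t\<in>J3. d t \<noteq> 0"
      using iff J3 by blast
    with J3 show "\<exists>c1 c2. \<forall>p\<in>box3 I1 I2 J3. V 1 p = c1 \<and> V 2 p = c2 / f2 p \<and>
        V 3 p = (deriv d (p $ 3) - (d (p $ 3))\<^sup>2) / d (p $ 3) \<and> lam p = 0 \<and>
        \<mu> p = - deriv (deriv d) (p $ 3) / d (p $ 3)
          + (deriv d (p $ 3) / d (p $ 3))\<^sup>2 + (d (p $ 3))\<^sup>2"
      by (intro exI) (rule curved; simp)
  qed
qed

end
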